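(* Let $n\ge 2$ and let $X=\sum_{i=1}^{2n^2}s_iA_i$ be a full-rate space-time code, where $A_1,\dots,A_{2n^2}\in M_n(\mathbb{C})$ are $\mathbb{R}$-linearly independent invertible matrices and the $s_i$ are real symbols from a finite nonempty set $S\subset\mathbb{R}$. Then the decoding complexity of $X$ is not better than (that is, is at least) $|S|^{n^2+1}$.
   Context: A space-time block code is $X=\sum_{i=1}^{2l}s_iA_i$ with $l\le n^2$ and $A_1,\dots,A_{2l}\in M_n(\mathbb{C})$ $\mathbb{R}$-linearly independent and invertible; it is full-rate if $l=n^2$. Matrices $A,B\in M_n(\mathbb{C})$ are mutually orthogonal if $AB^*+BA^*=0$, where $^*$ is conjugate transpose. The code admits fast decodability if for some $g\ge2$ there are pairwise disjoint subsets $\Gamma_1,\dots,\Gamma_g,\Gamma_{g+1}$ of $\{1,\dots,2l\}$ with union $\{1,\dots,2l\}$, with $\Gamma_1,\dots,\Gamma_g$ nonempty and $\Gamma_{g+1}$ possibly empty, such that $A_u$ and $A_v$ are mutually orthogonal whenever $u\in\Gamma_i$, $v\in\Gamma_j$, $1\le i<j\le g$. Put $n_i=|\Gamma_i|$. The decoding complexity of a fast decodable code (with respect to such a choice of subsets) is $|S|^{\,n_{g+1}+\max_{1\le i\le g}n_i}$; the lower bound is asserted for every such choice. For a code that is not fast decodable, the decoding complexity is the brute-force value $|S|^{2l}$. *)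

theory Defs
  imports "HOL-Analysis.Analysis"
begin

definition conj_transpose :: "complex^'n^'m \<Rightarrow> complex^'m^'n" where
  "conj_transpose A = map_matrix cnj (transpose A)"

definition mutually_orthogonal :: "complex^'n^'n \<Rightarrow> complex^'n^'n \<Rightarrow> bool" where
  "mutually_orthogonal A B \<longleftrightarrow> A ** conj_transpose B + B ** conj_transpose A = 0"

text \<open>The matrix size \<open>n\<close> is \<open>CARD('n)\<close>. Only the values of \<open>A\<close> on \<open>{1..2 * l}\<close> matter.
  Injectivity is needed because \<open>independent\<close> speaks about the set of weight matrices, whereas
  linear independence of the family also rules out repetitions.\<close>

definition space_time_block_code ::
    "nat \<Rightarrow> (nat \<Rightarrow> complex^'n^'n) \<Rightarrow> ((nat \<Rightarrow> real) \<Rightarrow> complex^'n^'n) \<Rightarrow> bool" where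
  "space_time_block_code l A X \<longleftrightarrow>
     l \<le> CARD('n)\<^sup>2 \<and>
     inj_on A {1..2 * l} \<and> independent (A ` {1..2 * l}) \<and>
     (\<forall>i\<in>{1..2 * l}. invertible (A i)) \<and>
     (\<forall>s. X s = (\<Sum>i\<in>{1..2 * l}. s i *\<^sub>R A i))"

definition full_rate ::
    "nat \<Rightarrow> (nat \<Rightarrow> complex^'n^'n) \<Rightarrow> ((nat \<Rightarrow> real) \<Rightarrow> complex^'n^'n) \<Rightarrow> bool" where
  "full_rate l A X \<longleftrightarrow> space_time_block_code l A X \<and> l = CARD('n)\<^sup>2"

definition fast_decodable_wrt ::
    "nat \<Rightarrow> (nat \<Rightarrow> complex^'n^'n) \<Rightarrow> nat \<Rightarrow> (nat \<Rightarrow> nat set) \<Rightarrow> bool" where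
  "fast_decodable_wrt l A g \<Gamma> \<longleftrightarrow>
     g \<ge> 2 \<and>
     disjoint_family_on \<Gamma> {1..g + 1} \<and>
     (\<Union>i\<in>{1..g + 1}. \<Gamma> i) = {1..2 * l} \<and>
     (\<forall>i\<in>{1..g}. \<Gamma> i \<noteq> {}) \<and>
     (\<forall>i j u v. 1 \<le> i \<and> i < j \<and> j \<le> g \<and> u \<in> \<Gamma> i \<and> v \<in> \<Gamma> j
        \<longrightarrow> mutually_orthogonal (A u) (A v))"

definition fast_decodable :: "nat \<Rightarrow> (nat \<Rightarrow> complex^'n^'n) \<Rightarrow> bool" where
  "fast_decodable l A \<longleftrightarrow> (\<exists>g \<Gamma>. fast_decodable_wrt l A g \<Gamma>)"

definition fast_complexity :: "real set \<Rightarrow> nat \<Rightarrow> (nat \<Rightarrow> nat set) \<Rightarrow> nat" where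
  "fast_complexity S g \<Gamma> =
     card S ^ (card (\<Gamma> (g + 1)) + Max ((\<lambda>i. card (\<Gamma> i)) ` {1..g}))"

text \<open>A relation rather than a function: the complexity of a fast decodable code depends on the
  chosen subsets, so one code may have several values \<open>c\<close>. The brute-force value is admitted
  only if no such choice exists.\<close>

definition is_decoding_complexity ::
    "real set \<Rightarrow> nat \<Rightarrow> (nat \<Rightarrow> complex^'n^'n) \<Rightarrow> nat \<Rightarrow> bool" where
  "is_decoding_complexity S l A c \<longleftrightarrow>
     (if fast_decodable l A
      then \<exists>g \<Gamma>. fast_decodable_wrt l A g \<Gamma> \<and> c = fast_complexity S g \<Gamma>
      else c = card S ^ (2 * l))"

end

theory Submission
  imports Defs
begin

text \<open>Suppose the symbols outside the largest of the mutually orthogonal groups (and outside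
  \<open>\<Gamma>\<^sub>g\<^sub>+\<^sub>1\<close>) number at least \<open>n\<^sup>2\<close>, and write \<open>W\<close> for their set.
  Multiplying by the inverse of a weight matrix of the largest group, we may assume that this
  matrix is \<open>1\<close>; then the weight matrices of \<open>W\<close> are skew-Hermitian, and by a dimension count
  they span all skew-Hermitian matrices. Any weight matrix of the largest group is orthogonal to
  that whole space, hence a real multiple of \<open>1\<close>, so all groups are singletons. The weight matrices
  of \<open>W\<close> are then pairwise anticommuting; comparing with \<open>\<i>\<close>, which lies in their span and is
  central, each of them is a real multiple of \<open>\<i>\<close>, contradicting independence.\<close>

section \<open>Algebra of the conjugate transpose and of orthogonality\<close>

lemma conj_transpose_component [simp]: "conj_transpose A $ i $ j = cnj (A $ j $ i)"
  by (simp add: conj_transpose_def map_matrix_def transpose_def)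

lemma conj_transpose_matrix_mult:
  fixes A B :: "complex^'n^'n"
  shows "conj_transpose (A ** B) = conj_transpose B ** conj_transpose A"
  by (simp add: vec_eq_iff matrix_matrix_mult_def mult.commute)

lemma conj_transpose_mat [simp]: "conj_transpose (mat c) = mat (cnj c)"
  by (simp add: vec_eq_iff mat_def)

lemma linear_conj_transpose: "linear (conj_transpose :: complex^'n^'m \<Rightarrow> complex^'m^'n)"
  by (rule linearI) (simp_all add: vec_eq_iff)

lemma matrix_add_rdistrib: "(A + B) ** C = A ** C + B ** (C :: 'a::semiring_1^'n^'m)"
  by (simp add: vec_eq_iff matrix_matrix_mult_def sum.distrib distrib_right)

lemma linear_matrix_mult_left:
  fixes A :: "complex^'n^'n"
  shows "linear (\<lambda>B :: complex^'n^'n. A ** B)"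
  by (rule linearI)
    (simp_all add: vec_eq_iff matrix_matrix_mult_def sum.distrib scaleR_sum_right algebra_simps)

lemma linear_matrix_mult_right:
  fixes B :: "complex^'n^'n"
  shows "linear (\<lambda>A :: complex^'n^'n. A ** B)"
  by (rule linearI)
    (simp_all add: vec_eq_iff matrix_matrix_mult_def sum.distrib scaleR_sum_right algebra_simps)

lemma mutually_orthogonal_commute: "mutually_orthogonal A B \<longleftrightarrow> mutually_orthogonal B A"
  by (simp add: mutually_orthogonal_def add.commute)

text \<open>The defining expression is merely multiplied by \<open>C\<close> on the left and by
  \<open>conj_transpose C\<close> on the right. This later allows one weight matrix to be normalised
  to the identity.\<close>

lemma mutually_orthogonal_mult_left:
  fixes A B C :: "complex^'n^'n"
  assumes "mutually_orthogonal A B"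
  shows "mutually_orthogonal (C ** A) (C ** B)"
proof -
  have "(C ** A) ** conj_transpose (C ** B) + (C ** B) ** conj_transpose (C ** A)
      = C ** (A ** conj_transpose B + B ** conj_transpose A) ** conj_transpose C"
    by (simp add: conj_transpose_matrix_mult matrix_mul_assoc matrix_add_ldistrib
        matrix_add_rdistrib)
  then show ?thesis
    using assms by (simp add: mutually_orthogonal_def)
qed

section \<open>Skew-Hermitian matrices and their real dimension\<close>

definition skew_hermitian :: "(complex^'n^'n) set" where
  "skew_hermitian = {B. conj_transpose B = - B}"

lemma mutually_orthogonal_one_iff:
  "mutually_orthogonal (mat 1) B \<longleftrightarrow> B \<in> skew_hermitian"
  by (simp add: mutually_orthogonal_def skew_hermitian_def eq_neg_iff_add_eq_0)

lemma subspace_skew_hermitian: "subspace skew_hermitian"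
  unfolding skew_hermitian_def
  by (rule subspaceI)
    (simp_all add: linear_0[OF linear_conj_transpose] linear_add[OF linear_conj_transpose]
      linear_cmul[OF linear_conj_transpose])

lemma mat_mult_component: "(mat c ** A) $ i $ j = c * A $ i $ j" for A :: "complex^'n^'n"
  by (simp add: matrix_matrix_mult_def mat_def if_distrib if_distribR cong: if_cong)

lemma mat_ii_mult_cancel: "mat \<i> ** A = mat \<i> ** B \<longleftrightarrow> A = (B :: complex^'n^'n)"
  by (simp add: vec_eq_iff mat_mult_component)

lemma mat_mult_commute: "mat c ** A = A ** (mat c :: complex^'n^'n)"
  by (simp add: vec_eq_iff matrix_matrix_mult_def mat_def if_distrib if_distribR mult.commute
      cong: if_cong)

text \<open>Multiplication by \<open>\<i>\<close> carries the skew-Hermitian matrices injectively to the Hermitian ones,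
  and the two spaces meet only in \<open>0\<close>.\<close>

lemma dim_skew_hermitian_le: "dim (skew_hermitian :: (complex^'n^'n) set) \<le> CARD('n)\<^sup>2"
proof -
  let ?S = "skew_hermitian :: (complex^'n^'n) set"
  let ?f = "\<lambda>B :: complex^'n^'n. mat \<i> ** B"
  have H: "subspace (?f ` ?S)"
    by (rule linear_subspace_image[OF linear_matrix_mult_left subspace_skew_hermitian])
  have dimH: "dim (?f ` ?S) = dim ?S"
    by (rule dim_image_eq[OF linear_matrix_mult_left]) (auto simp: inj_on_def mat_ii_mult_cancel)
  have "B = 0" if "B \<in> ?S" "B \<in> ?f ` ?S" for B
  proof -
    obtain C where C: "C \<in> ?S" "B = mat \<i> ** C" using \<open>B \<in> ?f ` ?S\<close> by auto
    have "cnj (B $ i $ j) = - B $ j $ i" for i j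
      using that(1) by (simp add: skew_hermitian_def vec_eq_iff)
    moreover have "cnj (C $ i $ j) = - C $ j $ i" for i j
      using C(1) by (simp add: skew_hermitian_def vec_eq_iff)
    moreover have "B $ i $ j = \<i> * C $ i $ j" for i j
      using C(2) by (simp add: mat_mult_component)
    ultimately show ?thesis by (simp add: vec_eq_iff)
  qed
  then have "?S \<inter> ?f ` ?S = {0}"
    using subspace_0[OF subspace_skew_hermitian] subspace_0[OF H] by auto
  then have "dim {x + y |x y. x \<in> ?S \<and> y \<in> ?f ` ?S} = 2 * dim ?S"
    using dim_sums_Int[OF subspace_skew_hermitian H] dimH by simp
  \<comment> \<open>The ambient real dimension is 2 n^2, twice the claimed bound.\<close>
  moreover have "dim {x + y |x y. x \<in> ?S \<and> y \<in> ?f ` ?S} \<le> DIM(complex^'n^'n)"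
    by (rule dim_subset_UNIV)
  ultimately show ?thesis by (simp add: power2_eq_square)
qed

section \<open>Matrices orthogonal to all skew-Hermitian ones\<close>

text \<open>Commuting with the matrix units \<open>?E\<close> suffices: comparing entries of the two
  products yields \<open>E\<close>.\<close>

lemma commutes_with_all_imp_scalar:
  fixes C :: "complex^'n^'n"
  assumes "\<And>M. C ** M = M ** C"
  obtains c where "C = mat c"
proof -
  have E: "C $ a $ i * (if b = j then 1 else 0) = (if a = i then 1 else 0) * C $ j $ b" for a b i j
  proof -
    let ?E = "(\<chi> p q. if p = i \<and> q = j then 1 else 0) :: complex^'n^'n"
    have "C $ a $ i * (if b = j then 1 else 0) = (C ** ?E) $ a $ b"
      by (cases "b = j") (simp_all add: matrix_matrix_mult_def if_distrib cong: if_cong)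
    also have "\<dots> = (?E ** C) $ a $ b" by (simp only: assms[of ?E])
    also have "\<dots> = (if a = i then 1 else 0) * C $ j $ b"
      by (cases "a = i") (simp_all add: matrix_matrix_mult_def if_distrib if_distribR cong: if_cong)
    finally show ?thesis .
  qed
  obtain k :: 'n where True by simp
  define c where "c = C $ k $ k"
  have "C $ a $ b = (if a = b then c else 0)" for a b
    \<comment> \<open>Positions follow the order of occurrence \<open>a\<close>, \<open>i\<close>,
      \<open>b\<close>, \<open>j\<close> in \<open>E\<close>. The first instance kills off-diagonal
      entries, the second equates every diagonal entry with the one at \<open>k\<close>.\<close>
    using E[of a b b b] E[of a a k k] by (cases "a = b") (auto simp: c_def)
  then have "C = mat c" by (simp add: vec_eq_iff mat_def)
  then show ?thesis by (rule that)
qed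

text \<open>Testing against the central matrix \<open>mat \<i>\<close> shows that \<open>C\<close>
  is Hermitian. Orthogonality then means commuting with all skew-Hermitian matrices, hence with all
  matrices. So \<open>C\<close> is scalar, and the scalar is real because \<open>C\<close> is
  Hermitian.\<close>

lemma orthogonal_skew_hermitian_imp_real:
  fixes C :: "complex^'n^'n"
  assumes orth: "\<And>B. B \<in> skew_hermitian \<Longrightarrow> mutually_orthogonal C B"
  obtains r where "C = r *\<^sub>R mat 1"
proof -
  have *: "C ** B = B ** conj_transpose C" if "B \<in> skew_hermitian" for B
  proof -
    have "C ** (- B) + B ** conj_transpose C = 0"
      using orth[OF that] that by (simp add: mutually_orthogonal_def skew_hermitian_def)
    then show ?thesis
      using linear_neg[OF linear_matrix_mult_left, of C B] by simp
  qed
  have "mat \<i> \<in> (skew_hermitian :: (complex^'n^'n) set)"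
    by (simp add: skew_hermitian_def vec_eq_iff mat_def)
  then have "mat \<i> ** C = mat \<i> ** conj_transpose C"
    using *[of "mat \<i>"] by (simp add: mat_mult_commute)
  then have herm: "conj_transpose C = C"
    by (simp add: mat_ii_mult_cancel)
  have comm: "C ** B = B ** C" if "B \<in> skew_hermitian" for B
    using *[OF that] herm by simp
  have "C ** M = M ** C" for M
  proof -
    \<comment> \<open>Twice \<open>M\<close> is a skew-Hermitian part plus a Hermitian part; the
      latter becomes skew-Hermitian after multiplication by \<i>, which is central and can be
      cancelled.\<close>
    let ?P = "M - conj_transpose M" and ?Q = "mat \<i> ** (M + conj_transpose M)"
    have "?P \<in> skew_hermitian"
      by (simp add: skew_hermitian_def vec_eq_iff)
    moreover have "?Q \<in> skew_hermitian"
      by (simp add: skew_hermitian_def vec_eq_iff mat_mult_component algebra_simps)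
    ultimately have P: "C ** ?P = ?P ** C" and Q: "C ** ?Q = ?Q ** C"
      using comm by auto
    have "mat \<i> ** (C ** (M + conj_transpose M)) = mat \<i> ** ((M + conj_transpose M) ** C)"
      using Q mat_mult_commute[of \<i> C] by (metis matrix_mul_assoc)
    then have Q': "C ** (M + conj_transpose M) = (M + conj_transpose M) ** C"
      by (simp only: mat_ii_mult_cancel)
    have M: "M = (1/2) *\<^sub>R (?P + (M + conj_transpose M))"
      by (simp add: vec_eq_iff)
    have "C ** (?P + (M + conj_transpose M)) = (?P + (M + conj_transpose M)) ** C"
      using P Q' by (simp only: matrix_add_ldistrib matrix_add_rdistrib)
    then show ?thesis
      using M linear_cmul[OF linear_matrix_mult_left] linear_cmul[OF linear_matrix_mult_right]
      by metis
  qed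
  then obtain c where c: "C = mat c" by (rule commutes_with_all_imp_scalar)
  obtain k :: 'n where True by simp
  have "conj_transpose C $ k $ k = C $ k $ k" using herm by simp
  then have "cnj c = c" by (simp add: c mat_def)
  then obtain r where "c = of_real r" by (metis Reals_cnj_iff Reals_cases)
  then have "C = r *\<^sub>R mat 1"
    using c by (simp add: vec_eq_iff mat_def scaleR_conv_of_real[where 'a = complex])
  then show ?thesis by (rule that)
qed

section \<open>Independence and anticommutation\<close>

lemma independent_family_not_in_span:
  assumes "inj_on A I" "independent (A ` I)" "b \<in> I" "J \<subseteq> I - {b}"
  shows "A b \<notin> span (A ` J)"
proof
  assume "A b \<in> span (A ` J)"
  moreover have "A ` J \<subseteq> A ` I - {A b}"
    using assms by (auto simp: inj_on_def)
  ultimately have "A b \<in> span (A ` I - {A b})"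
    using span_mono by blast
  then show False
    using assms by (auto simp: dependent_def)
qed

text \<open>Mutually orthogonal skew-Hermitian matrices anticommute. Splitting
  \<open>mat \<i>\<close> into a multiple of \<open>B\<close> and a remainder in the span of
  \<open>T\<close>, the remainder both commutes and anticommutes with \<open>B\<close>, so it
  vanishes.\<close>

lemma anticommuting_coefficient:
  fixes B :: "complex^'n^'n"
  assumes B: "B \<in> skew_hermitian" "invertible B"
    and T: "T \<subseteq> skew_hermitian" "\<And>D. D \<in> T \<Longrightarrow> mutually_orthogonal B D"
    and ii: "mat \<i> \<in> span (insert B T)"
  obtains k where "k *\<^sub>R B = mat \<i>"
proof -
  obtain k where k: "mat \<i> - k *\<^sub>R B \<in> span T"
    using ii span_breakdown_eq by metis
  have "subspace {D. B ** D + D ** B = 0}"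
    by (rule subspaceI)
      (auto simp: linear_0[OF linear_matrix_mult_left] linear_0[OF linear_matrix_mult_right]
        matrix_add_ldistrib matrix_add_rdistrib add_eq_0_iff algebra_simps
        linear_cmul[OF linear_matrix_mult_left] linear_cmul[OF linear_matrix_mult_right])
  moreover have "T \<subseteq> {D. B ** D + D ** B = 0}"
  proof
    fix D assume D: "D \<in> T"
    then have "B ** (- D) + D ** (- B) = 0"
      using T B by (force simp: mutually_orthogonal_def skew_hermitian_def)
    then show "D \<in> {D. B ** D + D ** B = 0}"
      using linear_neg[OF linear_matrix_mult_left, of B D]
        linear_neg[OF linear_matrix_mult_left, of D B] by (simp add: add_eq_0_iff)
  qed
  ultimately have "span T \<subseteq> {D. B ** D + D ** B = 0}"
    by (rule span_minimal[rotated])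
  with k have "B ** (mat \<i> - k *\<^sub>R B) + (mat \<i> - k *\<^sub>R B) ** B = 0" by blast
  \<comment> \<open>The remainder commutes with \<open>B\<close> because \<open>mat \<i>\<close> and
    \<open>B\<close> do, so the two summands agree.\<close>
  then have "2 *\<^sub>R (B ** (mat \<i> - k *\<^sub>R B)) = 0"
    using mat_mult_commute[of \<i> B]
    by (simp add: linear_diff[OF linear_matrix_mult_left] linear_diff[OF linear_matrix_mult_right]
        linear_cmul[OF linear_matrix_mult_left] linear_cmul[OF linear_matrix_mult_right] scaleR_2)
  then have "B ** (mat \<i> - k *\<^sub>R B) = 0" by simp
  moreover obtain B' where "B' ** B = mat 1"
    using B(2) by (auto simp: invertible_def)
  ultimately have "mat \<i> - k *\<^sub>R B = 0"
    by (metis matrix_mul_assoc matrix_mul_lid linear_0[OF linear_matrix_mult_left])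
  then show ?thesis using that[of k] by simp
qed

section \<open>Bounding the symbols orthogonal to a group\<close>

text \<open>In the application \<open>U\<close> is a largest group and \<open>W\<close> the union of
  the others. Orthogonality inside \<open>W\<close> is available only once \<open>U\<close> is a
  singleton, which the proof establishes first.\<close>

lemma card_orthogonal_to_one_less:
  fixes A :: "'i \<Rightarrow> complex^'n^'n"
  assumes n: "CARD('n) \<ge> 2"
    and inj: "inj_on A I" and ind: "independent (A ` I)"
    and inv: "\<And>i. i \<in> I \<Longrightarrow> invertible (A i)"
    and U: "U \<subseteq> I" "a \<in> U" "A a = mat 1" and W: "W \<subseteq> I"
    and UW: "\<And>u v. u \<in> U \<Longrightarrow> v \<in> W \<Longrightarrow> mutually_orthogonal (A u) (A v)"
    and WW: "\<And>u v. \<lbrakk>card U = 1; u \<in> W; v \<in> W; u \<noteq> v\<rbrakk> \<Longrightarrow> mutually_orthogonal (A u) (A v)"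
  shows "card W < CARD('n)\<^sup>2"
proof (rule ccontr)
  assume not_less: "\<not> card W < CARD('n)\<^sup>2"
  have skew: "A ` W \<subseteq> skew_hermitian"
    using UW[OF U(2)] U(3) by (auto simp: mutually_orthogonal_one_iff)
  have indW: "independent (A ` W)"
    using ind W by (meson image_mono independent_mono)
  have cardW: "card (A ` W) = card W"
    using inj W by (meson card_image inj_on_subset)
  have span: "skew_hermitian \<subseteq> span (A ` W)"
  proof (rule card_ge_dim_independent[OF skew indW])
    show "dim (skew_hermitian :: (complex^'n^'n) set) \<le> card (A ` W)"
      using dim_skew_hermitian_le[where 'n='n] not_less cardW by linarith
  qed
  have "u = a" if u: "u \<in> U" for u
  proof (rule ccontr)
    assume "u \<noteq> a"
    \<comment> \<open>Orthogonality to \<open>A u\<close> is a real-linear condition, so it passes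
      from the weight matrices of \<open>W\<close> to their span.\<close>
    have "subspace {B. mutually_orthogonal (A u) B}"
      unfolding mutually_orthogonal_def
      by (rule subspaceI)
        (auto simp: linear_0[OF linear_conj_transpose] linear_add[OF linear_conj_transpose]
          linear_cmul[OF linear_conj_transpose] matrix_add_ldistrib matrix_add_rdistrib
          linear_0[OF linear_matrix_mult_left] linear_0[OF linear_matrix_mult_right]
          linear_cmul[OF linear_matrix_mult_left] linear_cmul[OF linear_matrix_mult_right]
          add_eq_0_iff algebra_simps)
    then have "span (A ` W) \<subseteq> {B. mutually_orthogonal (A u) B}"
      using UW[OF u] by (intro span_minimal) auto
    then obtain r where "A u = r *\<^sub>R mat 1"
      using span orthogonal_skew_hermitian_imp_real[of "A u"] by blast
    then have "A u \<in> span (A ` {a})"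
      using U(3) by (simp add: span_base span_scale)
    then show False
      using independent_family_not_in_span[OF inj ind, of u "{a}"] u U \<open>u \<noteq> a\<close> by auto
  qed
  then have "U = {a}" using U(2) by blast
  then have orth: "mutually_orthogonal (A u) (A v)" if "u \<in> W" "v \<in> W" "u \<noteq> v" for u v
    using WW[of u v] that by simp
  have ii: "mat \<i> \<in> span (A ` W)"
    using span by (auto simp: skew_hermitian_def vec_eq_iff mat_def)
  have coeff: "\<exists>k. k *\<^sub>R A b = mat \<i>" if "b \<in> W" for b
  proof -
    have W_b: "A ` W = insert (A b) (A ` (W - {b}))" using that by auto
    show ?thesis
    proof (rule anticommuting_coefficient)
      show "A b \<in> skew_hermitian" using skew that by blast
      show "invertible (A b)" using inv W that by blast
      show "A ` (W - {b}) \<subseteq> skew_hermitian" using skew by blast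
      show "mutually_orthogonal (A b) D" if "D \<in> A ` (W - {b})" for D
        using that orth \<open>b \<in> W\<close> by auto
      show "mat \<i> \<in> span (insert (A b) (A ` (W - {b})))" by (rule ii[unfolded W_b])
    qed blast
  qed
  \<comment> \<open>Here n \<ge> 2 provides two distinct indices in \<open>W\<close>; for n = 1 the
    pair 1, \<i> would be a counterexample.\<close>
  have "2\<^sup>2 \<le> CARD('n)\<^sup>2" using n by (rule power_mono) simp
  then have "2 \<le> card W" using not_less by simp
  \<comment> \<open>An infinite set has \<open>card\<close> 0, so the lower bound forces
    finiteness.\<close>
  then have "finite W" "\<not> card W \<le> Suc 0"
    using card_ge_0_finite[of W] by linarith+
  then obtain b d where bd: "b \<in> W" "d \<in> W" "b \<noteq> d"
    using card_le_Suc0_iff_eq by blast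
  obtain k m where k: "k *\<^sub>R A b = mat \<i>" and m: "m *\<^sub>R A d = mat \<i>"
    using coeff bd by blast
  have "k \<noteq> 0"
    using k by (auto simp: vec_eq_iff mat_def split: if_splits)
  then have "A b = (1 / k) *\<^sub>R (k *\<^sub>R A b)" by simp
  also have "\<dots> = (m / k) *\<^sub>R A d" unfolding k m[symmetric] by simp
  finally have "A b = (m / k) *\<^sub>R A d" .
  then have "A b \<in> span (A ` {d})" by (simp add: span_base span_scale)
  then show False
    using independent_family_not_in_span[OF inj ind, of b "{d}"] bd W by auto
qed

text \<open>Reduction to the normalised case: left multiplication by the inverse \<open>P\<close> of
  some \<open>A a\<close> preserves all hypotheses and sends \<open>A a\<close> to the
  identity.\<close>

lemma card_orthogonal_less:
  fixes A :: "'i \<Rightarrow> complex^'n^'n"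
  assumes n: "CARD('n) \<ge> 2"
    and inj: "inj_on A I" and ind: "independent (A ` I)"
    and inv: "\<And>i. i \<in> I \<Longrightarrow> invertible (A i)"
    and U: "U \<subseteq> I" "U \<noteq> {}" and W: "W \<subseteq> I"
    and UW: "\<And>u v. u \<in> U \<Longrightarrow> v \<in> W \<Longrightarrow> mutually_orthogonal (A u) (A v)"
    and WW: "\<And>u v. \<lbrakk>card U = 1; u \<in> W; v \<in> W; u \<noteq> v\<rbrakk> \<Longrightarrow> mutually_orthogonal (A u) (A v)"
  shows "card W < CARD('n)\<^sup>2"
proof -
  obtain a where a: "a \<in> U" using U by auto
  then obtain P where P: "A a ** P = mat 1" "P ** A a = mat 1"
    using inv U by (auto simp: invertible_def)
  let ?f = "\<lambda>B :: complex^'n^'n. P ** B"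
  have inj_f: "inj ?f"
    by (metis (no_types, lifting) P(1) injI matrix_mul_assoc matrix_mul_lid)
  show ?thesis
  proof (rule card_orthogonal_to_one_less[OF n, where A = "\<lambda>i. P ** A i" and I = I and U = U])
    show "inj_on (\<lambda>i. P ** A i) I"
      using comp_inj_on[OF inj inj_on_subset[OF inj_f]] by (simp add: comp_def)
    have "independent (?f ` A ` I)"
      using linear_independent_injective_image[OF linear_matrix_mult_left ind]
        inj_on_subset[OF inj_f] by blast
    then show "independent ((\<lambda>i. P ** A i) ` I)" by (simp add: image_image)
    show "invertible (P ** A i)" if "i \<in> I" for i
      using P inv[OF that] by (intro invertible_mult) (auto simp: invertible_def)
  qed (use a U W P UW WW in \<open>auto intro: mutually_orthogonal_mult_left\<close>)
qed

section \<open>Counting the symbols of a fast decodable code\<close>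

lemma fast_exponent_ge:
  fixes A :: "nat \<Rightarrow> complex^'n^'n"
  assumes n: "CARD('n) \<ge> 2"
    and full: "full_rate l A X"
    and fast: "fast_decodable_wrt l A g \<Gamma>"
  shows "CARD('n)\<^sup>2 + 1 \<le> card (\<Gamma> (g + 1)) + Max ((\<lambda>i. card (\<Gamma> i)) ` {1..g})"
proof -
  let ?I = "{1..2 * l}"
  have g: "g \<ge> 2"
    and un: "(\<Union>i\<in>{1..g + 1}. \<Gamma> i) = ?I" and ne: "\<And>i. i \<in> {1..g} \<Longrightarrow> \<Gamma> i \<noteq> {}"
    and orth: "\<And>i j u v. \<lbrakk>1 \<le> i; i < j; j \<le> g; u \<in> \<Gamma> i; v \<in> \<Gamma> j\<rbrakk>
        \<Longrightarrow> mutually_orthogonal (A u) (A v)"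
    using fast unfolding fast_decodable_wrt_def by blast+
  have inj: "inj_on A ?I" and ind: "independent (A ` ?I)"
    and inv: "\<And>i. i \<in> ?I \<Longrightarrow> invertible (A i)" and l: "l = CARD('n)\<^sup>2"
    using full unfolding full_rate_def space_time_block_code_def by blast+
  have sub: "\<Gamma> i \<subseteq> ?I" if "i \<in> {1..g + 1}" for i
    using un that by blast
  have fin: "finite (\<Gamma> i)" if "i \<in> {1..g + 1}" for i
    using finite_subset[OF sub[OF that]] by simp
  have orth': "mutually_orthogonal (A u) (A v)"
    if "i \<in> {1..g}" "j \<in> {1..g}" "i \<noteq> j" "u \<in> \<Gamma> i" "v \<in> \<Gamma> j" for i j u v
    using that orth[of i j u v] orth[of j i v u] mutually_orthogonal_commute[of "A u" "A v"]
    by (cases "i < j") auto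
  let ?M = "Max ((\<lambda>i. card (\<Gamma> i)) ` {1..g})"
  have "?M \<in> (\<lambda>i. card (\<Gamma> i)) ` {1..g}" using g by (intro Max_in) auto
  then obtain m where m: "m \<in> {1..g}" "card (\<Gamma> m) = ?M" by auto
  have max: "card (\<Gamma> i) \<le> card (\<Gamma> m)" if "i \<in> {1..g}" for i
    using that by (simp add: m(2))
  define W where "W = (\<Union>i\<in>{1..g} - {m}. \<Gamma> i)"
  have less: "card W < CARD('n)\<^sup>2"
  proof (rule card_orthogonal_less[OF n inj ind inv])
    show "\<Gamma> m \<subseteq> ?I" using sub m by auto
    show "\<Gamma> m \<noteq> {}" using ne m by auto
    show "W \<subseteq> ?I" using sub by (fastforce simp: W_def)
    show "mutually_orthogonal (A u) (A v)" if "u \<in> \<Gamma> m" "v \<in> W" for u v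
      using that orth' m(1) unfolding W_def by blast
    show "mutually_orthogonal (A u) (A v)"
      if one: "card (\<Gamma> m) = 1" and uv: "u \<in> W" "v \<in> W" "u \<noteq> v" for u v
    proof -
      obtain i j where ij: "i \<in> {1..g}" "j \<in> {1..g}" "u \<in> \<Gamma> i" "v \<in> \<Gamma> j"
        using uv unfolding W_def by blast
      \<comment> \<open>If the largest group has one element, no group contains two distinct
        indices.\<close>
      have "i \<noteq> j"
        using max[OF ij(1)] one ij uv(3) fin[of i] card_le_Suc0_iff_eq[of "\<Gamma> i"] by auto
      then show ?thesis using orth' ij by blast
    qed
  qed
  have eq: "{1..g + 1} = insert (g + 1) (insert m ({1..g} - {m}))" using m(1) by auto
  have "?I = \<Gamma> (g + 1) \<union> (\<Gamma> m \<union> W)"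
    using un unfolding eq W_def UN_insert by (rule sym)
  then have "card ?I = card (\<Gamma> (g + 1) \<union> (\<Gamma> m \<union> W))" by (rule arg_cong)
  then have "2 * l \<le> card (\<Gamma> (g + 1)) + (card (\<Gamma> m) + card W)"
    using card_Un_le[of "\<Gamma> (g + 1)" "\<Gamma> m \<union> W"] card_Un_le[of "\<Gamma> m" W]
    unfolding card_atLeastAtMost by linarith
  \<comment> \<open>Of the 2 n^2 symbols at most n^2 - 1 lie in \<open>W\<close>, which leaves at
    least n^2 + 1.\<close>
  then show ?thesis using less m(2) l by linarith
qed

theorem theorem5:
  fixes A :: "nat \<Rightarrow> complex^'n^'n"
    and X :: "(nat \<Rightarrow> real) \<Rightarrow> complex^'n^'n"
    and S :: "real set"
    and l c :: nat
  assumes "CARD('n) \<ge> 2"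
    and "full_rate l A X"
    and "finite S" and "S \<noteq> {}"
    and "is_decoding_complexity S l A c"
  shows "c \<ge> card S ^ (CARD('n)\<^sup>2 + 1)"
proof -
  \<comment> \<open>This makes powers of \<open>card S\<close> monotone in the exponent.\<close>
  have S: "1 \<le> card S"
    using assms(3,4) by (simp add: Suc_le_eq card_gt_0_iff)
  show ?thesis
  proof (cases "fast_decodable l A")
    case True
    then obtain g \<Gamma> where fast: "fast_decodable_wrt l A g \<Gamma>"
      and c: "c = fast_complexity S g \<Gamma>"
      using assms(5) by (auto simp: is_decoding_complexity_def)
    show ?thesis
      unfolding c fast_complexity_def
      by (rule power_increasing[OF fast_exponent_ge[OF assms(1,2) fast] S])
  next
    case False
    have "1 \<le> CARD('n)\<^sup>2" by (simp add: Suc_le_eq)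
    moreover have "l = CARD('n)\<^sup>2" using assms(2) by (simp add: full_rate_def)
    ultimately have "CARD('n)\<^sup>2 + 1 \<le> 2 * l" by linarith
    then have "card S ^ (CARD('n)\<^sup>2 + 1) \<le> card S ^ (2 * l)" using S by (rule power_increasing)
    then show ?thesis
      using False assms(5) by (simp only: is_decoding_complexity_def if_False)
  qed
qed

end
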